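(* Let $H$ be a complex-norming bipartite graph. If $\alpha$ and $\beta$ are $2$-edge-colourings of $H$ such that both $(H,\alpha)$ and $(H,\beta)$ are complex-norming, then $(H,\alpha)$ and $(H,\beta)$ are isomorphic; that is, there is an automorphism $\phi$ of $H$ (preserving the two sides of the bipartition) with $\alpha(e)=\beta(\phi(e))$ for all $e\in E(H)$.
   Context: $\mathcal{F}_{\mathbb{C}}$ is the complex vector space of bounded measurable functions $f:[0,1]^2\to\mathbb{C}$; a "norm" on it is a seminorm $\|\cdot\|$ with $\|f\|=0$ iff $f=0$ a.e. A bipartite graph $H$ is finite, nonempty, without isolated vertices, with fixed bipartition $V(H)=A\cup B$; edges are ordered pairs $(u,v)$, $u\in A$, $v\in B$; isomorphisms and automorphisms must map $A$ to $A$ and $B$ to $B$. With variables $x_u\in[0,1]$ ($u\in A$), $y_v\in[0,1]$ ($v\in B$) and Lebesgue measure, for a $2$-edge-colouring $\alpha:E(H)\to\{0,1\}$ set $t_{H,\alpha}(f)=\int\prod_{e=(u,v)\in E(H)}f(x_u,y_v)^{\alpha(e)}\overline{f(x_u,y_v)}^{\,1-\alpha(e)}$. $(H,\alpha)$ is complex-norming if $f\mapsto|t_{H,\alpha}(f)|^{1/|E(H)|}$ is a norm on $\mathcal{F}_{\mathbb{C}}$; $H$ is complex-norming if some $\alpha$ makes $(H,\alpha)$ complex-norming. *)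

theory Defs
  imports "HOL-Analysis.Analysis"
begin

section \<open>Bipartite graphs with a fixed bipartition\<close>

record 'v bigraph =
  sideA :: "'v set"
  sideB :: "'v set"
  bedges :: "('v \<times> 'v) set"

definition bipartite_graph :: "'v bigraph \<Rightarrow> bool" where
  "bipartite_graph H \<longleftrightarrow>
     finite (sideA H) \<and> finite (sideB H) \<and> sideA H \<inter> sideB H = {} \<and>
     sideA H \<union> sideB H \<noteq> {} \<and>
     bedges H \<subseteq> sideA H \<times> sideB H \<and>
     (\<forall>u \<in> sideA H. \<exists>v. (u, v) \<in> bedges H) \<and>
     (\<forall>v \<in> sideB H. \<exists>u. (u, v) \<in> bedges H)"

definition bigraph_automorphism :: "'v bigraph \<Rightarrow> ('v \<Rightarrow> 'v) \<Rightarrow> bool" where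
  "bigraph_automorphism H \<phi> \<longleftrightarrow>
     bij_betw \<phi> (sideA H \<union> sideB H) (sideA H \<union> sideB H) \<and>
     \<phi> ` sideA H = sideA H \<and> \<phi> ` sideB H = sideB H \<and>
     (\<forall>u \<in> sideA H. \<forall>v \<in> sideB H. (u, v) \<in> bedges H \<longleftrightarrow> (\<phi> u, \<phi> v) \<in> bedges H)"

definition edge_colouring :: "'v bigraph \<Rightarrow> ('v \<times> 'v \<Rightarrow> nat) \<Rightarrow> bool" where
  "edge_colouring H \<alpha> \<longleftrightarrow> \<alpha> \<in> bedges H \<rightarrow> {0, 1}"


section \<open>Bounded measurable functions on the unit square\<close>

abbreviation unit_square :: "(real \<times> real) set" where
  "unit_square \<equiv> {0..1} \<times> {0..1}"

text \<open>
  A function on the unit square is represented by a function on the whole plane.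
  Its values outside the square are unconstrained, and nothing below depends on them.
\<close>

definition F_C :: "(real \<times> real \<Rightarrow> complex) set" where
  "F_C = {f. f \<in> borel_measurable (lebesgue_on unit_square) \<and> bounded (f ` unit_square)}"

definition norm_on_F_C :: "((real \<times> real \<Rightarrow> complex) \<Rightarrow> real) \<Rightarrow> bool" where
  "norm_on_F_C N \<longleftrightarrow>
     (\<forall>f \<in> F_C. 0 \<le> N f) \<and>
     (\<forall>f \<in> F_C. \<forall>g \<in> F_C. N (\<lambda>p. f p + g p) \<le> N f + N g) \<and>
     (\<forall>c. \<forall>f \<in> F_C. N (\<lambda>p. c * f p) = cmod c * N f) \<and>
     (\<forall>f \<in> F_C. N f = 0 \<longleftrightarrow> (AE p in lebesgue_on unit_square. f p = 0))"


section \<open>Complex-norming graphs\<close>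

text \<open>
  Lebesgue measure on the cube of all points \<open>z\<close> with one coordinate in the unit interval for
  each vertex. The completion is needed because \<open>f\<close> is only Lebesgue measurable: the integrand
  below need not be measurable for the product sigma-algebra itself.
\<close>

definition vertex_cube :: "'v bigraph \<Rightarrow> ('v \<Rightarrow> real) measure" where
  "vertex_cube H =
     completion (\<Pi>\<^sub>M w \<in> sideA H \<union> sideB H. restrict_space lborel {0..1})"

text \<open>
  As the two sides are disjoint, the variables \<open>x\<^sub>u\<close> and \<open>y\<^sub>v\<close> are the coordinates \<open>z u\<close> and
  \<open>z v\<close> of a single point \<open>z\<close>.
\<close>

definition t_hom ::
  "'v bigraph \<Rightarrow> ('v \<times> 'v \<Rightarrow> nat) \<Rightarrow> (real \<times> real \<Rightarrow> complex) \<Rightarrow> complex" where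
  "t_hom H \<alpha> f =
     (LINT z | vertex_cube H.
        (\<Prod>(u, v) \<in> bedges H. f (z u, z v) ^ \<alpha> (u, v) * cnj (f (z u, z v)) ^ (1 - \<alpha> (u, v))))"

definition complex_norming_pair :: "'v bigraph \<Rightarrow> ('v \<times> 'v \<Rightarrow> nat) \<Rightarrow> bool" where
  "complex_norming_pair H \<alpha> \<longleftrightarrow>
     norm_on_F_C (\<lambda>f. root (card (bedges H)) (cmod (t_hom H \<alpha> f)))"

definition complex_norming :: "'v bigraph \<Rightarrow> bool" where
  "complex_norming H \<longleftrightarrow> (\<exists>\<alpha>. edge_colouring H \<alpha> \<and> complex_norming_pair H \<alpha>)"

end

theory Submission
  imports Defs
begin

text \<open>
  Restrict everything to step functions, that is, to matrices indexed by a finite set \<open>I\<close>, where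
  \<open>t\<close> becomes a sum over all maps from the vertices to \<open>I\<close>. A tensor power argument turns the
  triangle inequality into a Hoelder inequality: \<open>t\<close> with a separate function on each edge is at
  most the product of the norms. Putting \<open>f\<close> or its conjugate on the edges gives
  \<open>\<bar>t\<^sub>\<alpha>(f)\<bar> = \<bar>t\<^sub>\<beta>(f)\<bar>\<close>. The Hoelder inequality is an equality when all the functions agree, and
  comparing derivatives there shows that the phase of \<open>t\<^sub>\<alpha>\<close> is locally constant; moving along a
  segment from the constant \<open>1\<close> to \<open>f\<close> yields \<open>t\<^sub>\<alpha>(f) > 0\<close>, so \<open>t\<^sub>\<alpha> = t\<^sub>\<beta>\<close>. Finally, on
  matrices supported on the edges of \<open>H\<close> itself, a Fourier coefficient of \<open>t\<^sub>\<alpha>\<close> counts the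
  colour-preserving endomorphisms.
\<close>

section \<open>Coloured sums over vertex maps\<close>

text \<open>Agrees with the factor \<open>x ^ k * cnj x ^ (1 - k)\<close> of \<open>t_hom\<close>
  for the colours 0 and 1, but is a ring homomorphism in \<open>x\<close> for every
  \<open>k\<close>, so it passes through sums and products.\<close>

definition tint :: "nat \<Rightarrow> complex \<Rightarrow> complex" where
  "tint k x = (if k = 1 then x else cnj x)"

lemma tint_simps:
  "tint k (x + y) = tint k x + tint k y"
  "tint k (x * y) = tint k x * tint k y"
  "tint k (cnj x) = cnj (tint k x)"
  "tint k (of_real r) = of_real r"
  "tint k 0 = 0"
  "tint k 1 = 1"
  "cmod (tint k x) = cmod x"
  by (simp_all add: tint_def)

lemma tint_sum: "tint k (\<Sum>s\<in>S. f s) = (\<Sum>s\<in>S. tint k (f s))"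
  by (simp add: tint_def)

lemma tint_prod: "tint k (\<Prod>s\<in>S. f s) = (\<Prod>s\<in>S. tint k (f s))"
  by (simp add: tint_def)

section \<open>Sums over vertex maps with a separate matrix on each edge\<close>

locale bipartite =
  fixes H :: "'v bigraph"
  assumes bipartite: "bipartite_graph H"
begin

abbreviation "E \<equiv> bedges H"
abbreviation "V \<equiv> sideA H \<union> sideB H"
abbreviation "n \<equiv> card (bedges H)"

lemma finite_V [simp]: "finite (sideA H)" "finite (sideB H)"
  using bipartite by (auto simp: bipartite_graph_def)

lemma finite_E [simp]: "finite E"
  using bipartite finite_subset[of E "sideA H \<times> sideB H"] by (auto simp: bipartite_graph_def)

lemma edge_ends:
  assumes "e \<in> E"
  shows "fst e \<in> sideA H" "snd e \<in> sideB H" "fst e \<in> V" "snd e \<in> V"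
  using assms bipartite by (auto simp: bipartite_graph_def)

lemma sides_disjoint: "sideA H \<inter> sideB H = {}"
  using bipartite by (auto simp: bipartite_graph_def)

lemma vertex_on_edge:
  assumes "v \<in> V"
  obtains e where "e \<in> E" "v = fst e \<or> v = snd e"
  using assms bipartite by (fastforce simp: bipartite_graph_def)

lemma E_nonempty: "E \<noteq> {}"
proof -
  obtain v where "v \<in> V"
    using bipartite by (auto simp: bipartite_graph_def)
  then show ?thesis
    by (rule vertex_on_edge) auto
qed

lemma n_pos: "n > 0"
  using E_nonempty by (simp add: card_gt_0_iff)

text \<open>Both sides of \<open>H\<close> are mapped into the same index set, so matrices are
  square and \<open>I\<close> may be the vertex set of \<open>H\<close> itself.\<close>

definition hsum :: "'i set \<Rightarrow> ('v \<times> 'v \<Rightarrow> 'i \<Rightarrow> 'i \<Rightarrow> complex) \<Rightarrow> complex" where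
  "hsum I g = (\<Sum>z \<in> V \<rightarrow>\<^sub>E I. \<Prod>e\<in>E. g e (z (fst e)) (z (snd e)))"

lemma finite_maps [simp]: "finite I \<Longrightarrow> finite (V \<rightarrow>\<^sub>E I)"
  by (rule finite_PiE) auto

lemma hsum_cong:
  assumes "\<And>e i j. e \<in> E \<Longrightarrow> i \<in> I \<Longrightarrow> j \<in> I \<Longrightarrow> g e i j = g' e i j"
  shows "hsum I g = hsum I g'"
  unfolding hsum_def
  by (intro sum.cong prod.cong refl assms) (auto dest: edge_ends)

text \<open>A family of vertex maps indexed by \<open>R\<close> is, with its two arguments swapped,
  a single vertex map into \<open>R \<rightarrow>\<^sub>E I\<close>.\<close>

lemma hsum_tensor:
  assumes "finite R" "finite I"
  shows "hsum (R \<rightarrow>\<^sub>E I) (\<lambda>e i j. \<Prod>r\<in>R. g r e (i r) (j r)) = (\<Prod>r\<in>R. hsum I (g r))"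
proof -
  have "(\<Prod>r\<in>R. hsum I (g r)) =
      (\<Sum>y \<in> R \<rightarrow>\<^sub>E (V \<rightarrow>\<^sub>E I). \<Prod>r\<in>R. \<Prod>e\<in>E. g r e (y r (fst e)) (y r (snd e)))"
    unfolding hsum_def using assms by (intro prod_sum_PiE) auto
  also have "\<dots> = hsum (R \<rightarrow>\<^sub>E I) (\<lambda>e i j. \<Prod>r\<in>R. g r e (i r) (j r))"
    unfolding hsum_def
  proof (rule sum.reindex_bij_witness[where
        i = "\<lambda>z. \<lambda>r\<in>R. \<lambda>v\<in>V. z v r" and j = "\<lambda>y. \<lambda>v\<in>V. \<lambda>r\<in>R. y r v"], goal_cases)
    case (1 y)
    then show ?case
      by (auto simp: fun_eq_iff PiE_iff extensional_def restrict_def)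
  next
    case (3 z)
    then show ?case
      by (auto simp: fun_eq_iff PiE_iff extensional_def restrict_def)
  next
    case (5 y)
    then show ?case
      by (subst prod.swap) (intro prod.cong refl, simp add: edge_ends(1,2))
  qed (auto simp: PiE_iff)
  finally show ?thesis ..
qed

text \<open>Leibniz rule: differentiation puts the direction \<open>q\<close> on one edge at a
  time.\<close>

lemma hsum_deriv:
  "((\<lambda>r. hsum I (\<lambda>e i j. p e i j + of_real r * q e i j)) has_vector_derivative
     (\<Sum>e\<in>E. hsum I ((\<lambda>e i j. p e i j + of_real s * q e i j)(e := q e)))) (at s)"
proof -
  have *: "(\<Prod>e'\<in>E. ((\<lambda>e i j. p e i j + of_real s * q e i j)(e := q e)) e' (z (fst e')) (z (snd e')))
      = q e (z (fst e)) (z (snd e)) *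
        (\<Prod>e'\<in>E - {e}. p e' (z (fst e')) (z (snd e')) + of_real s * q e' (z (fst e')) (z (snd e')))"
    if "e \<in> E" for e z
    using that by (subst prod.remove[of _ e]) (auto intro!: prod.cong)
  \<comment> \<open>Each summand is a polynomial in a complex variable; its complex derivative is
    restricted to the real line below.\<close>
  have **: "((\<lambda>x. \<Prod>e\<in>E. p e (z (fst e)) (z (snd e)) + x * q e (z (fst e)) (z (snd e)))
      has_field_derivative (\<Sum>e\<in>E. q e (z (fst e)) (z (snd e)) *
        (\<Prod>e'\<in>E - {e}. p e' (z (fst e')) (z (snd e')) + of_real s * q e' (z (fst e')) (z (snd e')))))
      (at (of_real s))" for z
    by (rule has_field_derivative_prod) (auto intro!: derivative_eq_intros)
  have "((\<lambda>r. hsum I (\<lambda>e i j. p e i j + of_real r * q e i j)) has_vector_derivative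
     (\<Sum>z \<in> V \<rightarrow>\<^sub>E I. \<Sum>e\<in>E. q e (z (fst e)) (z (snd e)) *
        (\<Prod>e'\<in>E - {e}. p e' (z (fst e')) (z (snd e')) + of_real s * q e' (z (fst e')) (z (snd e'))))) (at s)"
    unfolding hsum_def
    by (intro has_vector_derivative_sum has_vector_derivative_real_field **)
  also have "(\<Sum>z \<in> V \<rightarrow>\<^sub>E I. \<Sum>e\<in>E. q e (z (fst e)) (z (snd e)) *
        (\<Prod>e'\<in>E - {e}. p e' (z (fst e')) (z (snd e')) + of_real s * q e' (z (fst e')) (z (snd e'))))
     = (\<Sum>e\<in>E. hsum I ((\<lambda>e i j. p e i j + of_real s * q e i j)(e := q e)))"
    unfolding hsum_def by (subst sum.swap) (intro sum.cong refl *[symmetric])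
  finally show ?thesis .
qed

text \<open>With the same matrix on all edges this is \<open>t_hom\<close> of a step function, up to
  a power of the number of blocks; with different matrices it is the form bounded by the Hoelder
  inequality.\<close>

definition csum :: "('v \<times> 'v \<Rightarrow> nat) \<Rightarrow> 'i set \<Rightarrow> ('v \<times> 'v \<Rightarrow> 'i \<Rightarrow> 'i \<Rightarrow> complex) \<Rightarrow> complex" where
  "csum \<alpha> I f = hsum I (\<lambda>e i j. tint (\<alpha> e) (f e i j))"

lemma csum_cong:
  assumes "\<And>e i j. e \<in> E \<Longrightarrow> i \<in> I \<Longrightarrow> j \<in> I \<Longrightarrow> f e i j = f' e i j"
  shows "csum \<alpha> I f = csum \<alpha> I f'"
  unfolding csum_def by (intro hsum_cong) (simp add: assms)

lemma csum_tensor: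
  assumes "finite R" "finite I"
  shows "csum \<alpha> (R \<rightarrow>\<^sub>E I) (\<lambda>e i j. \<Prod>r\<in>R. g r e (i r) (j r)) = (\<Prod>r\<in>R. csum \<alpha> I (g r))"
  unfolding csum_def tint_prod by (rule hsum_tensor[OF assms])

text \<open>Multilinear expansion: every edge selects a summand independently.\<close>

lemma csum_sum:
  assumes "finite S"
  shows "csum \<alpha> I (\<lambda>_ i j. \<Sum>s\<in>S. a s i j) = (\<Sum>\<sigma> \<in> E \<rightarrow>\<^sub>E S. csum \<alpha> I (\<lambda>e. a (\<sigma> e)))"
  unfolding csum_def hsum_def tint_sum using assms
  by (subst sum.swap) (intro sum.cong refl prod_sum_PiE, auto)

lemma csum_scale:
  "csum \<alpha> I (\<lambda>e i j. c e * f e i j) = (\<Prod>e\<in>E. tint (\<alpha> e) (c e)) * csum \<alpha> I f"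
  by (simp add: csum_def hsum_def tint_simps prod.distrib sum_distrib_left)

lemma csum_cnj: "csum \<alpha> I (\<lambda>e i j. cnj (f e i j)) = cnj (csum \<alpha> I f)"
  by (simp add: csum_def hsum_def tint_simps)

lemma csum_eq_0:
  assumes "e \<in> E" "\<And>i j. i \<in> I \<Longrightarrow> j \<in> I \<Longrightarrow> f e i j = 0"
  shows "csum \<alpha> I f = 0"
proof -
  have "\<exists>e\<in>E. tint (\<alpha> e) (f e (z (fst e)) (z (snd e))) = 0" if "z \<in> V \<rightarrow>\<^sub>E I" for z
    using assms that edge_ends[OF assms(1)] by (intro bexI[of _ e]) (auto simp: tint_simps PiE_iff)
  then show ?thesis
    unfolding csum_def hsum_def by (intro sum.neutral ballI prod_zero) auto
qed

text \<open>The scalar is conjugated on edges whose colour is not 1; with \<open>c = \<i>\<close>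
  this separates the colours by a sign.\<close>

lemma csum_upd_add:
  assumes "e \<in> E"
  shows "csum \<alpha> I (f(e := \<lambda>i j. a i j + c * b i j)) =
    csum \<alpha> I (f(e := a)) + tint (\<alpha> e) c * csum \<alpha> I (f(e := b))"
proof -
  have *: "(\<Prod>e'\<in>E. tint (\<alpha> e') ((f(e := h)) e' (z (fst e')) (z (snd e')))) =
     tint (\<alpha> e) (h (z (fst e)) (z (snd e))) *
     (\<Prod>e'\<in>E - {e}. tint (\<alpha> e') (f e' (z (fst e')) (z (snd e'))))" for h z
    using assms by (subst prod.remove[of _ e]) (auto intro!: prod.cong)
  show ?thesis
    unfolding csum_def hsum_def * 
    by (simp add: tint_simps sum_distrib_left sum.distrib algebra_simps)
qed

lemma csum_deriv:
  "((\<lambda>r. csum \<alpha> I (\<lambda>_ i j. f i j + of_real r * g i j)) has_vector_derivative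
     (\<Sum>e\<in>E. csum \<alpha> I ((\<lambda>_ i j. f i j + of_real s * g i j)(e := g)))) (at s)"
proof -
  have "hsum I ((\<lambda>e i j. tint (\<alpha> e) (f i j) + of_real s * tint (\<alpha> e) (g i j))(e := \<lambda>i j. tint (\<alpha> e) (g i j)))
    = csum \<alpha> I ((\<lambda>_ i j. f i j + of_real s * g i j)(e := g))" for e
    unfolding csum_def by (intro hsum_cong) (auto simp: tint_simps)
  with hsum_deriv[of I "\<lambda>e i j. tint (\<alpha> e) (f i j)" "\<lambda>e i j. tint (\<alpha> e) (g i j)" s]
  show ?thesis
    by (simp add: csum_def tint_simps)
qed

lemma csum_one:
  "csum \<alpha> I (\<lambda>_ _ _. 1) = of_nat (card I ^ card V)"
  by (simp add: csum_def hsum_def tint_simps card_PiE)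

end

section \<open>Recovering the colouring from the coloured sums\<close>

text \<open>On roots of unity conjugation is inversion, so the sum is a geometric sum in a root of
  unity determined by \<open>p - q\<close>.\<close>

lemma ex_orthogonal_roots_of_unity:
  fixes M :: nat
  obtains W :: "complex set" where "finite W" "card W > 0" "\<And>w. w \<in> W \<Longrightarrow> w \<noteq> 0"
    "\<And>p q. p < M \<Longrightarrow> q < M \<Longrightarrow> (\<Sum>w\<in>W. w ^ p * cnj w ^ q) = (if p = q then of_nat (card W) else 0)"
proof -
  \<comment> \<open>The order \<open>Suc M\<close> is positive even for \<open>M = 0\<close>, so
    \<open>W\<close> is never empty.\<close>
  define m where "m = Suc M"
  define \<omega> where "\<omega> = (\<lambda>k. cis (2 * pi * k / m))"
  have inj: "inj_on \<omega> {..<m}"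
    unfolding \<omega>_def m_def using Complex.bij_betw_roots_unity[of "Suc M"] by (simp add: bij_betw_def)
  define W where "W = \<omega> ` {..<m}"
  have "(\<Sum>w\<in>W. w ^ p * cnj w ^ q) = (if p = q then of_nat (card W) else 0)" if pq: "p < M" "q < M" for p q
  proof -
    have card: "card W = m"
      using inj by (simp add: W_def card_image)
    define \<zeta> where "\<zeta> = cis (2 * pi * (real p - real q) / m)"
    have "\<omega> k ^ p * cnj (\<omega> k) ^ q = \<zeta> ^ k" for k
      by (simp add: \<omega>_def \<zeta>_def cis_cnj Complex.DeMoivre cis_mult) (simp add: algebra_simps diff_divide_distrib)
    then have sum: "(\<Sum>w\<in>W. w ^ p * cnj w ^ q) = (\<Sum>k<m. \<zeta> ^ k)"
      unfolding W_def by (subst sum.reindex[OF inj]) simp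
    show ?thesis
    proof (cases "p = q")
      case True
      then show ?thesis
        using sum card by (simp add: \<zeta>_def)
    next
      case False
      have "\<zeta> \<noteq> 1"
      \<comment> \<open>If \<open>\<zeta>\<close> were 1, then \<open>m\<close> would divide the
        nonzero integer \<open>p - q\<close>, whose absolute value is smaller.\<close>
      proof
        assume "\<zeta> = 1"
        then have "exp (\<i> * of_real (2 * pi * (real p - real q) / m)) = 1"
          by (simp add: \<zeta>_def cis_conv_exp)
        then obtain k :: int where "2 * pi * (real p - real q) / m = of_int (2 * k) * pi"
          unfolding exp_eq_1 by auto
        then have "(2 * pi) * ((real p - real q) / m) = (2 * pi) * k"
          by (simp add: mult_ac)
        then have "(real p - real q) / m = k"
          by (simp only: mult_cancel_left) simp
        then have "real p - real q = k * m"
          by (simp add: m_def field_simps)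
        then have "int p - int q = k * int m"
          by (metis of_int_eq_iff of_int_diff of_int_mult of_int_of_nat_eq)
        then have "int m dvd int p - int q"
          by simp
        moreover have "\<bar>int p - int q\<bar> < int m"
          using pq by (simp add: m_def)
        ultimately show False
          using dvd_imp_le_int[of "int p - int q" "int m"] False by simp
      qed
      moreover have "\<zeta> ^ m = 1"
      proof -
        have "real m * (2 * pi * (real p - real q) / m) = 2 * pi * (real p - real q)"
          by (simp add: m_def)
        then show ?thesis
          by (simp only: \<zeta>_def Complex.DeMoivre cis_multiple_2pi Ints_diff Ints_of_nat)
      qed
      ultimately show ?thesis
        using False sum by (simp add: sum_gp_strict)
    qed
  qed
  moreover have "finite W" "card W > 0" "\<And>w. w \<in> W \<Longrightarrow> w \<noteq> 0"
    by (auto simp: W_def card_gt_0_iff m_def \<omega>_def)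
  ultimately show ?thesis
    using that by blast
qed

section \<open>Fourier coefficients and colour-preserving endomorphisms\<close>

context bipartite
begin

text \<open>
  The second condition says that the power of \<open>x\<^sub>e\<close> (with conjugates counted as inverses) in the
  monomial of \<open>z\<close> with respect to \<open>\<beta>\<close> is the one in the monomial of the identity with respect to
  \<open>\<alpha>\<close>. As the latter is never zero, it forces \<open>z\<close> to be bijective on the edges.
\<close>

definition colour_hom :: "('v \<times> 'v \<Rightarrow> nat) \<Rightarrow> ('v \<times> 'v \<Rightarrow> nat) \<Rightarrow> ('v \<Rightarrow> 'v) \<Rightarrow> bool" where
  "colour_hom \<beta> \<alpha> z \<longleftrightarrow> (\<forall>e\<in>E. map_prod z z e \<in> E) \<and>
     (\<forall>e'\<in>E. card {e \<in> E. map_prod z z e = e' \<and> \<beta> e = 1} + (if \<alpha> e' = 1 then 0 else 1) =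
             card {e \<in> E. map_prod z z e = e' \<and> \<beta> e \<noteq> 1} + (if \<alpha> e' = 1 then 1 else 0))"

text \<open>Weighted adjacency matrix, oriented from the first side to the second. In
  \<open>csum\<close> over \<open>V\<close>, only maps sending edges to edges survive, and each
  contributes a monomial in the weights.\<close>

abbreviation edge_matrix :: "('v \<times> 'v \<Rightarrow> complex) \<Rightarrow> 'v \<Rightarrow> 'v \<Rightarrow> complex" where
  "edge_matrix x \<equiv> \<lambda>u v. if (u, v) \<in> E then x (u, v) else 0"

lemma prod_tint:
  assumes "finite S"
  shows "(\<Prod>e\<in>S. tint (\<beta> e) x) = x ^ card {e \<in> S. \<beta> e = 1} * cnj x ^ card {e \<in> S. \<beta> e \<noteq> 1}"
proof -
  have "(\<Prod>e\<in>S. tint (\<beta> e) x) = (\<Prod>e\<in>{e \<in> S. \<beta> e = 1}. tint (\<beta> e) x) * (\<Prod>e\<in>{e \<in> S. \<beta> e \<noteq> 1}. tint (\<beta> e) x)"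
    using assms by (subst prod.union_disjoint[symmetric]) (auto intro!: prod.cong)
  then show ?thesis
    by (simp add: tint_def)
qed

text \<open>Summation over the weights against the conjugate of the monomial of the identity
  factorises over the edges. Orthogonality then leaves exactly the vertex maps with matching
  exponents, each contributing \<open>card W ^ n\<close>.\<close>

lemma fourier_coefficient:
  assumes W: "finite W" "\<And>p q. p < n + 2 \<Longrightarrow> q < n + 2 \<Longrightarrow>
    (\<Sum>w\<in>W. w ^ p * cnj w ^ q) = (if p = q then of_nat (card W) else 0 :: complex)"
  shows "(\<Sum>x \<in> E \<rightarrow>\<^sub>E W. csum \<beta> V (\<lambda>_. edge_matrix x) * (\<Prod>e\<in>E. cnj (tint (\<alpha> e) (x e)))) =
    of_nat (card W ^ n * card {z \<in> V \<rightarrow>\<^sub>E V. colour_hom \<beta> \<alpha> z})"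
proof -
  have summand: "(\<Sum>x \<in> E \<rightarrow>\<^sub>E W. (\<Prod>e\<in>E. tint (\<beta> e) (edge_matrix x (z (fst e)) (z (snd e)))) *
       (\<Prod>e\<in>E. cnj (tint (\<alpha> e) (x e)))) = (if colour_hom \<beta> \<alpha> z then of_nat (card W ^ n) else 0)"
    if "z \<in> V \<rightarrow>\<^sub>E V" for z
  proof (cases "\<forall>e\<in>E. map_prod z z e \<in> E")
    case False
    then obtain e where "e \<in> E" "map_prod z z e \<notin> E"
      by blast
    then have "\<exists>e\<in>E. tint (\<beta> e) (edge_matrix x (z (fst e)) (z (snd e))) = 0" for x
      by (intro bexI[of _ e]) (auto simp: tint_simps map_prod_def split: prod.splits)
    then have "(\<Prod>e\<in>E. tint (\<beta> e) (edge_matrix x (z (fst e)) (z (snd e)))) = 0" for x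
      by (intro prod_zero) auto
    moreover have "\<not> colour_hom \<beta> \<alpha> z"
      using False by (auto simp: colour_hom_def)
    ultimately show ?thesis
      by (simp only: mult_zero_left sum.neutral_const if_False)
  next
    case True
    define p where "p = (\<lambda>e'. card {e \<in> E. map_prod z z e = e' \<and> \<beta> e = 1} + (if \<alpha> e' = 1 then 0 else 1))"
    define q where "q = (\<lambda>e'. card {e \<in> E. map_prod z z e = e' \<and> \<beta> e \<noteq> 1} + (if \<alpha> e' = 1 then 1 else 0))"
    \<comment> \<open>At most \<open>n\<close> edges are mapped onto \<open>e'\<close>, and the
      reference monomial adds at most one; hence the bound \<open>n + 2\<close> in the orthogonality
      hypothesis.\<close>
    have pq: "p e' < n + 2" "q e' < n + 2" for e'
    proof -
      have "card {e \<in> E. map_prod z z e = e' \<and> P e} \<le> n" for P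
        by (rule card_mono) auto
      from this[of "\<lambda>e. \<beta> e = 1"] this[of "\<lambda>e. \<beta> e \<noteq> 1"] show "p e' < n + 2" "q e' < n + 2"
        by (simp_all add: p_def q_def)
    qed
    \<comment> \<open>Grouping the edges by their image collects the powers of each weight.\<close>
    have "(\<Prod>e\<in>E. tint (\<beta> e) (edge_matrix x (z (fst e)) (z (snd e)))) * (\<Prod>e\<in>E. cnj (tint (\<alpha> e) (x e)))
        = (\<Prod>e'\<in>E. x e' ^ p e' * cnj (x e') ^ q e')" for x
    proof -
      have "(\<Prod>e\<in>E. tint (\<beta> e) (edge_matrix x (z (fst e)) (z (snd e)))) =
         (\<Prod>e\<in>E. tint (\<beta> e) (x (map_prod z z e)))"
        using True by (intro prod.cong) auto
      also have "\<dots> = (\<Prod>e'\<in>E. \<Prod>e\<in>{e \<in> E. map_prod z z e = e'}. tint (\<beta> e) (x (map_prod z z e)))"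
        using True by (intro prod.group[symmetric]) auto
      also have "\<dots> = (\<Prod>e'\<in>E. \<Prod>e\<in>{e \<in> E. map_prod z z e = e'}. tint (\<beta> e) (x e'))"
        by (intro prod.cong) auto
      also have "\<dots> = (\<Prod>e'\<in>E. x e' ^ card {e \<in> E. map_prod z z e = e' \<and> \<beta> e = 1} *
          cnj (x e') ^ card {e \<in> E. map_prod z z e = e' \<and> \<beta> e \<noteq> 1})"
        by (simp add: prod_tint conj_assoc)
      finally have "(\<Prod>e\<in>E. tint (\<beta> e) (edge_matrix x (z (fst e)) (z (snd e)))) * (\<Prod>e\<in>E. cnj (tint (\<alpha> e) (x e)))
        = (\<Prod>e'\<in>E. x e' ^ card {e \<in> E. map_prod z z e = e' \<and> \<beta> e = 1} *
          cnj (x e') ^ card {e \<in> E. map_prod z z e = e' \<and> \<beta> e \<noteq> 1} * cnj (tint (\<alpha> e') (x e')))"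
        by (simp add: prod.distrib)
      also have "\<dots> = (\<Prod>e'\<in>E. x e' ^ p e' * cnj (x e') ^ q e')"
        by (intro prod.cong refl) (simp add: p_def q_def tint_def)
      finally show ?thesis .
    qed
    then have "(\<Sum>x \<in> E \<rightarrow>\<^sub>E W. (\<Prod>e\<in>E. tint (\<beta> e) (edge_matrix x (z (fst e)) (z (snd e)))) *
       (\<Prod>e\<in>E. cnj (tint (\<alpha> e) (x e)))) = (\<Sum>x \<in> E \<rightarrow>\<^sub>E W. \<Prod>e'\<in>E. x e' ^ p e' * cnj (x e') ^ q e')"
      by simp
    also have "\<dots> = (\<Prod>e'\<in>E. \<Sum>w\<in>W. w ^ p e' * cnj w ^ q e')"
      using W(1) by (subst prod_sum_PiE) auto
    also have "\<dots> = (\<Prod>e'\<in>E. if p e' = q e' then of_nat (card W) else 0)"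
      by (simp only: W(2)[OF pq])
    also have "\<dots> = (if \<forall>e'\<in>E. p e' = q e' then of_nat (card W ^ n) else 0)"
      by (auto intro: prod_zero)
    finally show ?thesis
      using True by (simp add: colour_hom_def p_def q_def)
  qed
  have "(\<Sum>x \<in> E \<rightarrow>\<^sub>E W. csum \<beta> V (\<lambda>_. edge_matrix x) * (\<Prod>e\<in>E. cnj (tint (\<alpha> e) (x e)))) =
    (\<Sum>z \<in> V \<rightarrow>\<^sub>E V. \<Sum>x \<in> E \<rightarrow>\<^sub>E W. (\<Prod>e\<in>E. tint (\<beta> e) (edge_matrix x (z (fst e)) (z (snd e)))) *
       (\<Prod>e\<in>E. cnj (tint (\<alpha> e) (x e))))"
    unfolding csum_def hsum_def sum_distrib_right by (rule sum.swap)
  also have "\<dots> = (\<Sum>z \<in> V \<rightarrow>\<^sub>E V. if colour_hom \<beta> \<alpha> z then of_nat (card W ^ n) else 0)"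
    by (intro sum.cong refl summand)
  also have "\<dots> = of_nat (card W ^ n * card {z \<in> V \<rightarrow>\<^sub>E V. colour_hom \<beta> \<alpha> z})"
    by (simp add: sum.If_cases Int_def mult.commute)
  finally show ?thesis .
qed

text \<open>Ensures that the Fourier coefficient for \<open>\<beta> = \<alpha>\<close> is not
  zero.\<close>

lemma colour_hom_id: "colour_hom \<alpha> \<alpha> (restrict id V)"
proof -
  have id: "map_prod (restrict id V) (restrict id V) e = e" if "e \<in> E" for e
    using edge_ends[OF that] by (cases e) auto
  have "{e \<in> E. map_prod (restrict id V) (restrict id V) e = e' \<and> P e} = (if P e' then {e'} else {})"
    if "e' \<in> E" for e' P
  proof -
    have "{e \<in> E. map_prod (restrict id V) (restrict id V) e = e' \<and> P e} = {e \<in> E. e = e' \<and> P e}"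
      using id by metis
    then show ?thesis
      using that by auto
  qed
  then show ?thesis
    by (auto simp: colour_hom_def id)
qed

text \<open>Once \<open>z\<close> is bijective on edges, every count is 0 or 1 and the colours can
  be read off. Bijectivity passes to the vertices because each of them lies on an edge.\<close>

lemma colour_hom_automorphism:
  assumes z: "z \<in> V \<rightarrow>\<^sub>E V" "colour_hom \<beta> \<alpha> z"
    and \<alpha>: "edge_colouring H \<alpha>" and \<beta>: "edge_colouring H \<beta>"
  obtains \<phi> where "bigraph_automorphism H \<phi>" "\<And>e. e \<in> E \<Longrightarrow> \<alpha> e = \<beta> (map_prod \<phi> \<phi> e)"
proof -
  let ?z = "map_prod z z"
  have hom: "?z e \<in> E" if "e \<in> E" for e
    using z(2) that by (auto simp: colour_hom_def)
  have cnt: "card {e \<in> E. ?z e = e' \<and> \<beta> e = 1} + (if \<alpha> e' = 1 then 0 else 1) =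
             card {e \<in> E. ?z e = e' \<and> \<beta> e \<noteq> 1} + (if \<alpha> e' = 1 then 1 else 0)" if "e' \<in> E" for e'
    using z(2) that by (auto simp: colour_hom_def)
  have "e' \<in> ?z ` E" if e': "e' \<in> E" for e'
  proof (rule ccontr)
    assume "e' \<notin> ?z ` E"
    then have "{e \<in> E. ?z e = e' \<and> \<beta> e = 1} = {}" "{e \<in> E. ?z e = e' \<and> \<beta> e \<noteq> 1} = {}"
      by auto
    \<comment> \<open>For an edge without preimage the counting condition would read 0 = 1 or 1 =
      0.\<close>
    then show False
      using cnt[OF e'] by (simp only: card.empty split: if_splits)
  qed
  then have surjE: "?z ` E = E"
    using hom by auto
  then have injE: "inj_on ?z E"
    by (intro eq_card_imp_inj_on) auto
  have col: "\<alpha> (?z e) = \<beta> e" if e: "e \<in> E" for e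
  proof -
    have "{e' \<in> E. ?z e' = ?z e \<and> P e'} = (if P e then {e} else {})" for P
      using e injE by (auto simp: inj_on_def)
    then have "(\<alpha> (?z e) = 1) = (\<beta> e = 1)"
      using cnt[OF hom[OF e]] by (auto split: if_splits)
    moreover have "\<alpha> (?z e) \<in> {0, 1}" "\<beta> e \<in> {0, 1}"
      using \<alpha> \<beta> e hom[OF e] unfolding edge_colouring_def by (blast dest: funcset_mem)+
    ultimately show ?thesis
      by auto
  qed
  have surjV: "z ` V = V"
  proof
    show "z ` V \<subseteq> V"
      using z(1) by auto
    show "V \<subseteq> z ` V"
    proof
      fix v assume "v \<in> V"
      then obtain e where e: "e \<in> E" "v = fst e \<or> v = snd e"
        by (rule vertex_on_edge)
      from e(1) have "e \<in> ?z ` E"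
        by (simp only: surjE)
      then obtain e' where e': "e = ?z e'" "e' \<in> E"
        by (rule imageE)
      then have "v = z (fst e') \<or> v = z (snd e')"
        using e(2) by simp
      then show "v \<in> z ` V"
        using edge_ends(3,4)[OF e'(2)] by blast
    qed
  qed
  moreover have "inj_on z V"
    by (rule eq_card_imp_inj_on) (simp_all only: surjV, simp)
  ultimately have bij: "bij_betw z V V"
    by (simp only: bij_betw_def)
  \<comment> \<open>The map \<open>z\<close> satisfies \<open>\<alpha> (?z e) = \<beta> e\<close>,
    so the required automorphism is its inverse.\<close>
  define \<phi> where "\<phi> = inv_into V z"
  have bij\<phi>: "bij_betw \<phi> V V"
    unfolding \<phi>_def by (rule bij_betw_inv_into[OF bij])
  have \<phi>z: "\<phi> (z v) = v" if "v \<in> V" for v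
    using bij_betw_inv_into_left[OF bij that] by (simp add: \<phi>_def)
  have z\<phi>: "z (\<phi> v) = v" if "v \<in> V" for v
    using bij_betw_inv_into_right[OF bij that] by (simp add: \<phi>_def)
  have \<phi>E: "map_prod \<phi> \<phi> e \<in> E" "?z (map_prod \<phi> \<phi> e) = e" if e: "e \<in> E" for e
  proof -
    have "e \<in> ?z ` E"
      using e by (simp only: surjE)
    then obtain e' where e': "e = ?z e'" "e' \<in> E"
      by (rule imageE)
    then have "map_prod \<phi> \<phi> e = e'"
      using \<phi>z edge_ends(3,4)[OF e'(2)] by (cases e') simp
    with e' show "map_prod \<phi> \<phi> e \<in> E" "?z (map_prod \<phi> \<phi> e) = e"
      by auto
  qed
  \<comment> \<open>A vertex is an end of some edge, and the image of that edge is again an edge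
    with the same order of its ends; this keeps the sides apart.\<close>
  have subA: "\<phi> ` sideA H \<subseteq> sideA H" and subB: "\<phi> ` sideB H \<subseteq> sideB H"
  proof -
    show "\<phi> ` sideA H \<subseteq> sideA H"
    proof
      fix u assume "u \<in> \<phi> ` sideA H"
      then obtain v where v: "u = \<phi> v" "v \<in> sideA H"
        by blast
      then obtain w where "(v, w) \<in> E"
        using bipartite unfolding bipartite_graph_def by blast
      with v(1) show "u \<in> sideA H"
        using \<phi>E(1)[of "(v, w)"] edge_ends(1) by fastforce
    qed
    show "\<phi> ` sideB H \<subseteq> sideB H"
    proof
      fix u assume "u \<in> \<phi> ` sideB H"
      then obtain v where v: "u = \<phi> v" "v \<in> sideB H"
        by blast
      then obtain w where "(w, v) \<in> E"
        using bipartite unfolding bipartite_graph_def by blast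
      with v(1) show "u \<in> sideB H"
        using \<phi>E(1)[of "(w, v)"] edge_ends(2) by fastforce
    qed
  qed
  have inj: "inj_on \<phi> (sideA H)" "inj_on \<phi> (sideB H)"
    using bij\<phi> by (auto simp: bij_betw_def intro: inj_on_subset)
  have "bigraph_automorphism H \<phi>"
    unfolding bigraph_automorphism_def
  proof (intro conjI ballI)
    show "\<phi> ` sideA H = sideA H" "\<phi> ` sideB H = sideB H"
      using endo_inj_surj[OF _ subA inj(1)] endo_inj_surj[OF _ subB inj(2)] by simp_all
    fix u v assume uv: "u \<in> sideA H" "v \<in> sideB H"
    show "(u, v) \<in> E \<longleftrightarrow> (\<phi> u, \<phi> v) \<in> E"
      using \<phi>E(1)[of "(u, v)"] hom[of "(\<phi> u, \<phi> v)"] z\<phi> uv by auto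
  qed (rule bij\<phi>)
  moreover have "\<alpha> e = \<beta> (map_prod \<phi> \<phi> e)" if "e \<in> E" for e
    using col[OF \<phi>E(1)[OF that]] \<phi>E(2)[OF that] by simp
  ultimately show ?thesis
    using that by blast
qed

end

section \<open>Step functions\<close>

text \<open>The minimum only serves to put the point \<open>1\<close> into the last block.\<close>

definition block :: "nat \<Rightarrow> real \<Rightarrow> nat" where
  "block N x = min (N - 1) (nat \<lfloor>real N * x\<rfloor>)"

text \<open>The enumeration \<open>h\<close> allows matrices over any finite index set, such as a
  tensor power or the vertex set of \<open>H\<close>.\<close>

definition step :: "nat \<Rightarrow> (nat \<Rightarrow> 'i) \<Rightarrow> ('i \<Rightarrow> 'i \<Rightarrow> complex) \<Rightarrow> real \<times> real \<Rightarrow> complex" where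
  "step N h a p = a (h (block N (fst p))) (h (block N (snd p)))"

lemma block_less: "N > 0 \<Longrightarrow> block N x < N"
  by (simp add: block_def)

lemma block_eq:
  assumes "k < N" "real k / real N \<le> x" "x < (real k + 1) / real N"
  shows "block N x = k"
proof -
  have "real k \<le> real N * x" "real N * x < real k + 1"
    using assms by (simp_all add: field_simps)
  then have "\<lfloor>real N * x\<rfloor> = int k"
    by (intro floor_unique) auto
  then show ?thesis
    using assms(1) by (simp add: block_def)
qed

text \<open>The upper bound is not strict because the last block contains the point 1.\<close>

lemma block_bounds:
  assumes "x \<in> {0..1}" "N > 0" "block N x = k"
  shows "real k / real N \<le> x" "x \<le> (real k + 1) / real N"
proof -
  have Nx: "0 \<le> real N * x" "real N * x \<le> real N"
    using assms by (auto simp: mult_le_cancel_left1)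
  have fl: "real (nat \<lfloor>real N * x\<rfloor>) \<le> real N * x" "real N * x < real (nat \<lfloor>real N * x\<rfloor>) + 1"
    using Nx by (auto simp: of_nat_nat)
  have "k \<le> nat \<lfloor>real N * x\<rfloor>"
    using assms(3) by (simp add: block_def)
  then have "real k \<le> real N * x"
    using fl(1) by linarith
  moreover have "k = nat \<lfloor>real N * x\<rfloor> \<or> N = k + 1"
    using assms(2,3) by (auto simp: block_def min_def)
  then have "real N * x \<le> real k + 1"
  proof
    assume "N = k + 1"
    then have "real N = real k + 1"
      by simp
    then show ?thesis
      using Nx(2) by linarith
  qed (use fl(2) in simp)
  ultimately have "real k \<le> real N * x" "real N * x \<le> real k + 1"
    by auto
  then show "real k / real N \<le> x" "x \<le> (real k + 1) / real N"
    using assms(2) by (simp_all add: field_simps)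
qed

lemma block_subset_unit:
  assumes "k < N" "real k / real N \<le> x" "x \<le> (real k + 1) / real N"
  shows "0 \<le> x" "x \<le> 1"
proof -
  have "0 \<le> real k / real N" "(real k + 1) / real N \<le> 1"
    using assms(1) by auto
  then show "0 \<le> x" "x \<le> 1"
    using assms(2,3) by linarith+
qed

lemma measurable_block [measurable]: "block N \<in> borel \<rightarrow>\<^sub>M count_space UNIV"
  unfolding block_def[abs_def] by measurable

abbreviation unit_interval :: "real measure" where
  "unit_interval \<equiv> restrict_space lborel {0..1}"

text \<open>The block lies between a half-open and a closed interval, both of length
  \<open>1 / N\<close>.\<close>

lemma measure_block:
  assumes "k < N"
  shows "measure unit_interval ({x. block N x = k} \<inter> space unit_interval) = 1 / N"
proof -
  define B where "B = {x. block N x = k} \<inter> {0..1}"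
  have B [measurable]: "B \<in> sets lborel"
    unfolding B_def by measurable
  have sub: "{real k / real N..<(real k + 1) / real N} \<subseteq> B"
    using block_eq[OF assms] block_subset_unit[OF assms] by (auto simp: B_def)
  have sup: "B \<subseteq> {real k / real N..(real k + 1) / real N}"
    using block_bounds[of _ N k] assms by (auto simp: B_def)
  have len: "(real k + 1) / real N - real k / real N = 1 / real N"
    by (simp add: diff_divide_distrib[symmetric])
  have le: "real k / real N \<le> (real k + 1) / real N"
    by (simp add: divide_right_mono)
  have fm: "{real k / real N..(real k + 1) / real N} \<in> fmeasurable lborel"
    by (rule fmeasurable_compact) simp
  have "measure lborel B \<le> measure lborel {real k / real N..(real k + 1) / real N}"
    by (rule measure_mono_fmeasurable[OF sup B fm])
  moreover have "measure lborel {real k / real N..<(real k + 1) / real N} \<le> measure lborel B"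
    by (rule measure_mono_fmeasurable[OF sub _ fmeasurableI2[OF fm sup B]]) simp
  ultimately have "measure lborel B = 1 / N"
    using le len by simp
  then show ?thesis
    by (simp add: measure_restrict_space space_restrict_space B_def)
qed

lemma step_in_F_C: "step N h a \<in> F_C"
proof -
  have "step N h a \<in> borel_measurable borel"
  proof -
    have "(\<lambda>p. (\<lambda>(k, l). a (h k) (h l)) (block N (fst p), block N (snd p))) \<in> borel_measurable (borel :: (real \<times> real) measure)"
      by (rule measurable_compose[of _ _ "count_space UNIV"]) (auto simp: borel_prod[symmetric])
    then show ?thesis
      by (simp add: step_def[abs_def])
  qed
  then have "step N h a \<in> borel_measurable (lebesgue_on unit_square)"
    by (intro measurable_restrict_space1 measurable_completion) simp
  moreover have "bounded (step N h a ` unit_square)"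
  proof (rule finite_imp_bounded, rule finite_subset)
    show "step N h a ` unit_square \<subseteq> (\<lambda>(k, l). a (h k) (h l)) ` ({..N - 1} \<times> {..N - 1})"
      by (force simp: step_def block_def)
  qed auto
  ultimately show ?thesis
    by (simp add: F_C_def)
qed

text \<open>A nonzero entry keeps the function away from 0 on a nonempty open rectangle, which is
  not negligible.\<close>

lemma step_AE_zero:
  assumes "AE p in lebesgue_on unit_square. step N h a p = 0" "k < N" "l < N"
  shows "a (h k) (h l) = 0"
proof (rule ccontr)
  assume nz: "a (h k) (h l) \<noteq> 0"
  define B where "B = {real k / N<..<(real k + 1) / N} \<times> {real l / N<..<(real l + 1) / N}"
  have "B \<subseteq> unit_square"
    using block_subset_unit[OF assms(2)] block_subset_unit[OF assms(3)] by (auto simp: B_def)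
  moreover have "step N h a p \<noteq> 0" if "p \<in> B" for p
    using that nz block_eq[OF assms(2), of "fst p"] block_eq[OF assms(3), of "snd p"]
    by (auto simp: step_def B_def)
  moreover have "unit_square \<in> sets lebesgue"
    by (intro sets_completionI_sets) (auto intro!: borel_closed closed_Times)
  then have "AE p in lebesgue. p \<in> unit_square \<longrightarrow> step N h a p = 0"
    using assms(1) by (subst (asm) AE_restrict_space_iff) auto
  ultimately have "AE p in lebesgue. p \<notin> B"
    by (auto elim: eventually_mono)
  moreover have "open B"
    unfolding B_def by (intro open_Times) auto
  ultimately have "negligible B"
    by (simp add: negligible_iff_null_sets AE_iff_null_sets lmeasurable_iff_integrable)
  moreover have "real i / N < (real i + 1) / N" for i
    using assms(2) by (intro divide_strict_right_mono) auto
  then have "B \<noteq> {}"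
    by (simp add: B_def not_le)
  ultimately show False
    using \<open>open B\<close> open_not_negligible by blast
qed

context bipartite
begin

text \<open>The integrand is constant on products of blocks. Written as a combination of products of
  indicators, its integral splits into one-variable integrals, each equal to
  \<open>1 / N\<close>.\<close>

lemma t_hom_step:
  assumes col: "edge_colouring H \<alpha>" and h: "bij_betw h {..<N} I" and N: "N > 0"
  shows "t_hom H \<alpha> (step N h a) = csum \<alpha> I (\<lambda>_. a) / of_nat N ^ card V"
proof -
  have I: "finite I"
    using h bij_betw_finite by blast
  define Q where "Q = (\<lambda>y. \<Prod>e\<in>E. tint (\<alpha> e) (a (y (fst e)) (y (snd e))))"
  define S where "S = (\<lambda>i. {x. h (block N x) = i})"
  have hI: "h (block N x) \<in> I" for x
    using h block_less[OF N] by (auto simp: bij_betw_def)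
  have S_eq: "S (h k) = {x. block N x = k}" if "k < N" for k
    using h that block_less[OF N] by (auto simp: S_def bij_betw_def inj_on_def)
  have S_block: "\<exists>k<N. S i = {x. block N x = k}" if "i \<in> I" for i
    using S_eq h that by (auto simp: bij_betw_def)
  have S_sets [measurable]: "S i \<in> sets borel" if "i \<in> I" for i
    using S_block[OF that] by auto
  have integrand: "(\<Prod>(u, v)\<in>E. step N h a (z u, z v) ^ \<alpha> (u, v) * cnj (step N h a (z u, z v)) ^ (1 - \<alpha> (u, v))) =
    (\<Sum>y \<in> V \<rightarrow>\<^sub>E I. Q y * (\<Prod>v\<in>V. of_real (indicator (S (y v)) (z v))))" for z
  proof -
    \<comment> \<open>At a given point only the map sending each vertex to the index of its block
      contributes.\<close>
    define \<rho> where "\<rho> = (\<lambda>v\<in>V. h (block N (z v)))"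
    have \<rho>: "\<rho> \<in> V \<rightarrow>\<^sub>E I"
      using hI by (auto simp: \<rho>_def)
    have "(\<Prod>v\<in>V. of_real (indicator (S (y v)) (z v))) = (if y = \<rho> then 1 else 0 :: complex)"
      if y: "y \<in> V \<rightarrow>\<^sub>E I" for y
    proof (cases "y = \<rho>")
      case False
      then obtain v where "v \<in> V" "y v \<noteq> \<rho> v"
        using y \<rho> by (metis PiE_ext)
      then have "\<exists>v\<in>V. of_real (indicator (S (y v)) (z v)) = (0::complex)"
        by (intro bexI[of _ v]) (auto simp: S_def \<rho>_def)
      with False show ?thesis
        by (simp only: if_False) (intro prod_zero, auto)
    qed (auto simp: S_def \<rho>_def intro!: prod.neutral)
    then have "(\<Sum>y \<in> V \<rightarrow>\<^sub>E I. Q y * (\<Prod>v\<in>V. of_real (indicator (S (y v)) (z v)))) =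
        (\<Sum>y \<in> V \<rightarrow>\<^sub>E I. if y = \<rho> then Q \<rho> else 0)"
      by (intro sum.cong) auto
    also have "\<dots> = Q \<rho>"
      using \<rho> I by simp
    also have "Q \<rho> = (\<Prod>e\<in>E. tint (\<alpha> e) (step N h a (z (fst e), z (snd e))))"
      unfolding Q_def by (intro prod.cong refl) (simp add: \<rho>_def step_def edge_ends(1,2))
    also have "\<dots> = (\<Prod>(u, v)\<in>E. step N h a (z u, z v) ^ \<alpha> (u, v) * cnj (step N h a (z u, z v)) ^ (1 - \<alpha> (u, v)))"
      using col by (intro prod.cong refl) (auto simp: edge_colouring_def tint_def Pi_iff split: prod.splits)
    finally show ?thesis ..
  qed
  have fin: "finite_measure unit_interval"
    by (intro finite_measureI) (simp add: emeasure_restrict_space space_restrict_space)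
  interpret product_sigma_finite "\<lambda>_::'v. unit_interval"
    using fin by (simp add: product_sigma_finite_def finite_measure.axioms(1))
  have meas: "(\<lambda>x. of_real (indicator (S i) x) :: complex) \<in> borel_measurable unit_interval" if "i \<in> I" for i
    using S_sets[OF that] by (intro measurable_restrict_space1) simp
  have int: "integrable unit_interval (\<lambda>x. of_real (indicator (S i) x) :: complex)" if "i \<in> I" for i
    using meas[OF that] by (intro finite_measure.integrable_const_bound[OF fin, of _ 1]) (auto simp: indicator_def)
  have val: "(LINT x|unit_interval. of_real (indicator (S i) x) :: complex) = 1 / of_nat N" if i: "i \<in> I" for i
    using S_block[OF i] measure_block[of _ N] by (auto simp: integral_complex_of_real)
  let ?P = "\<Pi>\<^sub>M w\<in>V. unit_interval"
  have intP: "integrable ?P (\<lambda>z. \<Prod>v\<in>V. of_real (indicator (S (y v)) (z v)) :: complex)"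
    if "y \<in> V \<rightarrow>\<^sub>E I" for y
    using that by (intro product_integrable_prod int) auto
  have "t_hom H \<alpha> (step N h a) = (LINT z|completion ?P.
      (\<Sum>y \<in> V \<rightarrow>\<^sub>E I. Q y * (\<Prod>v\<in>V. of_real (indicator (S (y v)) (z v)))))"
    unfolding t_hom_def vertex_cube_def integrand ..
  also have "\<dots> = (LINT z|?P. (\<Sum>y \<in> V \<rightarrow>\<^sub>E I. Q y * (\<Prod>v\<in>V. of_real (indicator (S (y v)) (z v)))))"
    by (intro integral_completion borel_measurable_sum borel_measurable_times borel_measurable_const
        borel_measurable_integrable intP)
  also have "\<dots> = (\<Sum>y \<in> V \<rightarrow>\<^sub>E I. Q y * (LINT z|?P. (\<Prod>v\<in>V. of_real (indicator (S (y v)) (z v)))))"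
    using intP by (subst Bochner_Integration.integral_sum) auto
  also have "\<dots> = (\<Sum>y \<in> V \<rightarrow>\<^sub>E I. Q y * (\<Prod>v\<in>V. LINT x|unit_interval. of_real (indicator (S (y v)) x)))"
    by (intro sum.cong refl arg_cong2[where f = times] product_integral_prod int) auto
  also have "\<dots> = (\<Sum>y \<in> V \<rightarrow>\<^sub>E I. Q y * (1 / of_nat N) ^ card V)"
  proof (intro sum.cong refl arg_cong2[where f = times])
    fix y assume "y \<in> V \<rightarrow>\<^sub>E I"
    then have "(\<Prod>v\<in>V. LINT x|unit_interval. of_real (indicator (S (y v)) x) :: complex) = (\<Prod>v\<in>V. 1 / of_nat N)"
      by (intro prod.cong refl val) auto
    then show "(\<Prod>v\<in>V. LINT x|unit_interval. of_real (indicator (S (y v)) x) :: complex) = (1 / of_nat N) ^ card V"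
      by simp
  qed
  also have "\<dots> = csum \<alpha> I (\<lambda>_. a) / of_nat N ^ card V"
    by (simp add: csum_def hsum_def Q_def sum_divide_distrib power_one_over)
  finally show ?thesis .
qed

end

section \<open>Norming colourings\<close>

text \<open>Squaring makes the modulus differentiable at zeros of \<open>f\<close> as well.\<close>

lemma has_real_derivative_cmod_squared:
  assumes "(f has_vector_derivative f') (at x)"
  shows "((\<lambda>r. cmod (f r) ^ 2) has_real_derivative 2 * Re (cnj (f x) * f')) (at x)"
proof -
  have Re': "((\<lambda>r. Re (f r)) has_real_derivative Re f') (at x)"
    and Im': "((\<lambda>r. Im (f r)) has_real_derivative Im f') (at x)"
    using assms by (auto simp: has_vector_derivative_complex_iff)
  show ?thesis
    unfolding cmod_power2
    using DERIV_add[OF DERIV_power[OF Re', of 2] DERIV_power[OF Im', of 2]]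
    by (simp add: algebra_simps)
qed

lemma prod_cis: "(\<Prod>e\<in>S. cis (x e)) = cis (\<Sum>e\<in>S. x e)"
  by (induction S rule: infinite_finite_induct) (auto simp: cis_mult)

section \<open>The norm axioms for matrices\<close>

locale norming_colouring = bipartite H for H :: "'v bigraph" +
  fixes \<alpha> :: "'v \<times> 'v \<Rightarrow> nat"
  assumes colouring: "edge_colouring H \<alpha>"
    and norming: "complex_norming_pair H \<alpha>"
begin

text \<open>Differs from the norm of the step function by a factor depending only on the number of
  indices, which cancels in the triangle inequality.\<close>

abbreviation "tnorm I f \<equiv> root n (cmod (csum \<alpha> I (\<lambda>_. f)))"

lemma root_t_hom_step:
  assumes "bij_betw h {..<N} I" "N > 0"
  shows "root n (cmod (t_hom H \<alpha> (step N h a))) = tnorm I a / root n (real N ^ card V)"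
  unfolding t_hom_step[OF colouring assms] by (simp add: norm_divide norm_power real_root_divide)

lemma enumerate_indices:
  assumes "finite I" "I \<noteq> {}"
  obtains N h where "bij_betw h {..<N} I" "N > (0::nat)"
proof -
  obtain h where "bij_betw h {..<card I} I"
    using ex_bij_betw_nat_finite[OF assms(1)] by (auto simp: atLeast0LessThan)
  then show ?thesis
    using assms by (intro that) (auto simp: card_gt_0_iff)
qed

lemma tnorm_triangle:
  assumes "finite I" "I \<noteq> {}"
  shows "tnorm I (\<lambda>i j. a i j + b i j) \<le> tnorm I a + tnorm I b"
proof -
  obtain N h where h: "bij_betw h {..<N} I" "N > (0::nat)"
    using enumerate_indices[OF assms] .
  have pos: "root n (real N ^ card V) > 0"
    using h(2) n_pos by simp
  have "root n (cmod (t_hom H \<alpha> (\<lambda>p. step N h a p + step N h b p)))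
      \<le> root n (cmod (t_hom H \<alpha> (step N h a))) + root n (cmod (t_hom H \<alpha> (step N h b)))"
    using norming step_in_F_C unfolding complex_norming_pair_def norm_on_F_C_def by blast
  moreover have "(\<lambda>p. step N h a p + step N h b p) = step N h (\<lambda>i j. a i j + b i j)"
    by (simp add: step_def fun_eq_iff)
  ultimately show ?thesis
    using pos by (simp add: root_t_hom_step[OF h] divide_le_cancel flip: add_divide_distrib)
qed

text \<open>Definiteness of the norm, applied to a step function.\<close>

lemma csum_nonzero:
  assumes "finite I" "i \<in> I" "j \<in> I" "a i j \<noteq> 0"
  shows "csum \<alpha> I (\<lambda>_. a) \<noteq> 0"
proof
  assume "csum \<alpha> I (\<lambda>_. a) = 0"
  moreover obtain N h where h: "bij_betw h {..<N} I" "N > (0::nat)"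
    using enumerate_indices[OF assms(1)] assms(2) by blast
  ultimately have "root n (cmod (t_hom H \<alpha> (step N h a))) = 0"
    by (simp add: root_t_hom_step)
  then have "AE p in lebesgue_on unit_square. step N h a p = 0"
    using norming step_in_F_C[of N h a] unfolding complex_norming_pair_def norm_on_F_C_def by blast
  then have "a (h k) (h l) = 0" if "k < N" "l < N" for k l
    using step_AE_zero that by blast
  moreover obtain k l where "k < N" "i = h k" "l < N" "j = h l"
    using h(1) assms(2,3) by (auto simp: bij_betw_def)
  ultimately show False
    using assms(4) by blast
qed

lemma tnorm_sum:
  assumes "finite I" "I \<noteq> {}" "finite S"
  shows "tnorm I (\<lambda>i j. \<Sum>s\<in>S. a s i j) \<le> (\<Sum>s\<in>S. tnorm I (a s))"
  using assms(3)
proof (induction S rule: finite_induct)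
  case empty
  then show ?case
    using E_nonempty n_pos by (auto simp: csum_eq_0)
next
  case (insert s S)
  then show ?case
    using tnorm_triangle[OF assms(1,2), of "a s" "\<lambda>i j. \<Sum>s\<in>S. a s i j"] by simp
qed

section \<open>The Hoelder inequality\<close>

lemma prod_alternating_cnj:
  "(\<Prod>r<2 * m. if even r then t else cnj t) = complex_of_real (cmod t ^ (2 * m))"
proof (induction m)
  case (Suc m)
  have "t * cnj t = complex_of_real (cmod t ^ 2)"
    by (rule complex_norm_square[symmetric])
  with Suc show ?case
    by (simp add: mult.assoc power2_eq_square mult_ac)
qed simp

text \<open>
  Pairing every factor with its conjugate in \<open>F\<close> makes all terms of the expansion of
  \<open>t(\<Sum>\<^sub>e F\<^sub>e)\<close> nonnegative, so that each of them is bounded by the whole sum.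
\<close>

lemma hoelder_normalised:
  fixes g :: "'v \<times> 'v \<Rightarrow> 'i \<Rightarrow> 'i \<Rightarrow> complex"
  assumes I: "finite I" "I \<noteq> {}" and g: "\<And>e. e \<in> E \<Longrightarrow> cmod (csum \<alpha> I (\<lambda>_. g e)) = 1"
  shows "cmod (csum \<alpha> I g) \<le> 1"
proof (rule ccontr)
  assume "\<not> ?thesis"
  then have gt: "cmod (csum \<alpha> I g) > 1"
    by simp
  \<comment> \<open>Tensor power trick: the right side does not depend on \<open>m\<close>, whereas
    a base above 1 would make the left side unbounded.\<close>
  have bound: "cmod (csum \<alpha> I g) ^ (2 * m) \<le> real n ^ n" for m
  proof -
    define R J where "R = {..<2 * m}" and "J = R \<rightarrow>\<^sub>E I"
    define g' where "g' = (\<lambda>(r::nat) e i j. if even r then g e i j else cnj (g e i j))"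
    define F where "F = (\<lambda>e i j. \<Prod>r\<in>R. g' r e (i r) (j r))"
    have R: "finite R"
      by (simp add: R_def)
    have J: "finite J" "J \<noteq> {}"
      using I R by (auto simp: J_def PiE_eq_empty_iff intro: finite_PiE)
    \<comment> \<open>An arbitrary assignment \<open>\<sigma>\<close> of matrices to edges is
      treated, since these are the terms in the expansion of the sum of all
      \<open>F e\<close>.\<close>
    have F: "csum \<alpha> J (\<lambda>e. F (\<sigma> e)) =
        of_real (cmod (csum \<alpha> I (\<lambda>e. g (\<sigma> e))) ^ (2 * m))" for \<sigma> :: "'v \<times> 'v \<Rightarrow> 'v \<times> 'v"
    proof -
      have "csum \<alpha> J (\<lambda>e. F (\<sigma> e)) = (\<Prod>r\<in>R. csum \<alpha> I (\<lambda>e. g' r (\<sigma> e)))"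
        unfolding J_def F_def by (rule csum_tensor[OF R I(1)])
      also have "\<dots> = (\<Prod>r<2 * m. if even r then csum \<alpha> I (\<lambda>e. g (\<sigma> e)) else cnj (csum \<alpha> I (\<lambda>e. g (\<sigma> e))))"
        unfolding R_def g'_def
        by (intro prod.cong refl) (auto simp: csum_cnj)
      finally show ?thesis
        unfolding prod_alternating_cnj .
    qed
    have "tnorm J (F e) = 1" if "e \<in> E" for e
      using F[of "\<lambda>_. e"] g[OF that] n_pos by simp
    then have "(\<Sum>e\<in>E. tnorm J (F e)) = real n"
      by simp
    then have "tnorm J (\<lambda>i j. \<Sum>e\<in>E. F e i j) \<le> real n"
      using tnorm_sum[OF J finite_E, of F] by simp
    then have "tnorm J (\<lambda>i j. \<Sum>e\<in>E. F e i j) ^ n \<le> real n ^ n"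
      by (intro power_mono) (auto intro!: real_root_ge_zero)
    then have upper: "cmod (csum \<alpha> J (\<lambda>_ i j. \<Sum>e\<in>E. F e i j)) \<le> real n ^ n"
      using n_pos by simp
    \<comment> \<open>The wanted term belongs to the identity, restricted to \<open>E\<close> so
      that it lies in the index set of the expansion.\<close>
    have "cmod (csum \<alpha> I g) ^ (2 * m) =
        cmod (csum \<alpha> I (\<lambda>e. g (restrict id E e))) ^ (2 * m)"
      by (intro arg_cong2[where f = power] arg_cong[where f = cmod] csum_cong) auto
    also have "\<dots> \<le> (\<Sum>\<sigma> \<in> E \<rightarrow>\<^sub>E E. cmod (csum \<alpha> I (\<lambda>e. g (\<sigma> e))) ^ (2 * m))"
      by (rule member_le_sum) (auto intro!: finite_PiE)
    also have "\<dots> = cmod (\<Sum>\<sigma> \<in> E \<rightarrow>\<^sub>E E. csum \<alpha> J (\<lambda>e. F (\<sigma> e)))"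
      unfolding F of_real_sum[symmetric] norm_of_real by (simp add: sum_nonneg)
    also have "\<dots> \<le> real n ^ n"
      using upper unfolding csum_sum[OF finite_E] .
    finally show ?thesis .
  qed
  have "(1::real) < cmod (csum \<alpha> I g) ^ 2"
    using gt by (simp add: power_gt1_lemma one_less_power)
  then obtain m where "real n ^ n < (cmod (csum \<alpha> I g) ^ 2) ^ m"
    using real_arch_pow by blast
  with bound[of m] show False
    by (simp add: power_mult)
qed

text \<open>Dividing each matrix by its norm reduces to the normalised case. If one of the norms is
  0, that matrix vanishes by definiteness, and so does the left side.\<close>

lemma hoelder:
  assumes I: "finite I" "I \<noteq> {}"
  shows "cmod (csum \<alpha> I f) ^ n \<le> (\<Prod>e\<in>E. cmod (csum \<alpha> I (\<lambda>_. f e)))"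
proof (cases "\<exists>e\<in>E. csum \<alpha> I (\<lambda>_. f e) = 0")
  case True
  then obtain e where e: "e \<in> E" "csum \<alpha> I (\<lambda>_. f e) = 0"
    by blast
  then have "csum \<alpha> I f = 0"
    using csum_nonzero[OF I(1)] by (intro csum_eq_0[OF e(1)]) blast
  then show ?thesis
    using n_pos by (simp add: power_0_left prod_nonneg)
next
  case False
  define c where "c = (\<lambda>e. tnorm I (f e))"
  have c: "c e > 0" "c e ^ n = cmod (csum \<alpha> I (\<lambda>_. f e))" if "e \<in> E" for e
    using False that n_pos by (auto simp: c_def)
  define g where "g = (\<lambda>e i j. of_real (inverse (c e)) * f e i j)"
  have "cmod (csum \<alpha> I (\<lambda>_. g e)) = 1" if "e \<in> E" for e
    using c[OF that] unfolding g_def csum_scale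
    by (simp add: tint_simps norm_mult norm_inverse power_inverse flip: prod_norm c(2)[OF that])
  from hoelder_normalised[OF I this] have "cmod (csum \<alpha> I g) \<le> 1"
    by simp
  moreover have "csum \<alpha> I g = of_real (inverse (\<Prod>e\<in>E. c e)) * csum \<alpha> I f"
    unfolding g_def csum_scale tint_simps(4) by (simp add: o_def flip: prod_inversef)
  moreover have pos: "(\<Prod>e\<in>E. c e) > 0"
    using c by (intro prod_pos) auto
  ultimately have "cmod (csum \<alpha> I f) \<le> (\<Prod>e\<in>E. c e)"
    by (simp add: norm_divide field_simps flip: of_real_prod)
  then have "cmod (csum \<alpha> I f) ^ n \<le> (\<Prod>e\<in>E. c e) ^ n"
    by (intro power_mono) auto
  also have "\<dots> = (\<Prod>e\<in>E. cmod (csum \<alpha> I (\<lambda>_. f e)))"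
    using c(2) by (simp add: prod_power_distrib)
  finally show ?thesis .
qed

text \<open>Conjugating \<open>f\<close> on the edges where the colourings differ turns
  \<open>\<beta>\<close> into \<open>\<alpha>\<close> and does not change the norm of any factor in
  the Hoelder inequality.\<close>

lemma csum_recolour_le:
  assumes "finite I" "I \<noteq> {}"
  shows "cmod (csum \<beta> I (\<lambda>_. f)) \<le> cmod (csum \<alpha> I (\<lambda>_. f))"
proof -
  define F where "F = (\<lambda>e. if (\<alpha> e = 1) = (\<beta> e = 1) then f else (\<lambda>i j. cnj (f i j)))"
  have "csum \<beta> I (\<lambda>_. f) = csum \<alpha> I F"
    unfolding csum_def F_def by (intro hsum_cong) (auto simp: tint_def)
  moreover have "cmod (csum \<alpha> I (\<lambda>_. F e)) = cmod (csum \<alpha> I (\<lambda>_. f))" for e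
    by (simp add: F_def csum_cnj)
  ultimately have "cmod (csum \<beta> I (\<lambda>_. f)) ^ n \<le> cmod (csum \<alpha> I (\<lambda>_. f)) ^ n"
    using hoelder[OF assms, of F] by simp
  then show ?thesis
    using n_pos by (simp add: power_mono_iff)
qed

section \<open>The phase of the coloured sum\<close>

text \<open>With \<open>f\<close> perturbed on the edge \<open>e\<close> alone, the Hoelder
  inequality is an equality at \<open>r = 0\<close>, so the difference of its sides has a minimum
  there and zero derivative. Consequently all edges contribute the same real part.\<close>

lemma directional_derivative_edge:
  assumes I: "finite I" "I \<noteq> {}" and t: "csum \<alpha> I (\<lambda>_. f) \<noteq> 0" and e: "e \<in> E"
  shows "Re (cnj (csum \<alpha> I (\<lambda>_. f)) * (\<Sum>e\<in>E. csum \<alpha> I ((\<lambda>_. f)(e := g)))) =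
    n * Re (cnj (csum \<alpha> I (\<lambda>_. f)) * csum \<alpha> I ((\<lambda>_. f)(e := g)))"
proof -
  define \<tau> where "\<tau> = csum \<alpha> I (\<lambda>_. f)"
  define \<tau>e where "\<tau>e = csum \<alpha> I ((\<lambda>_. f)(e := g))"
  define D where "D = (\<Sum>e\<in>E. csum \<alpha> I ((\<lambda>_. f)(e := g)))"
  define \<phi> where "\<phi> = (\<lambda>r::real. csum \<alpha> I (\<lambda>_ i j. f i j + of_real r * g i j))"
  \<comment> \<open>Difference of the two sides of the Hoelder inequality, squared to be
    differentiable.\<close>
  define \<psi> where "\<psi> = (\<lambda>r. (cmod \<tau> ^ 2) ^ (n - 1) * cmod (\<phi> r) ^ 2 - (cmod (\<tau> + of_real r * \<tau>e) ^ 2) ^ n)"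
  have \<phi>0: "\<phi> 0 = \<tau>"
    by (simp add: \<phi>_def \<tau>_def)
  have \<phi>': "(\<phi> has_vector_derivative D) (at 0)"
    using csum_deriv[of \<alpha> I f g 0] by (simp add: \<phi>_def D_def)
  have \<psi>_nonneg: "\<psi> r \<ge> 0" for r
  proof -
    define F where "F = (\<lambda>_. f)(e := (\<lambda>i j. f i j + of_real r * g i j))"
    have "csum \<alpha> I F = \<tau> + of_real r * \<tau>e"
      unfolding F_def csum_upd_add[OF e] by (simp add: fun_upd_idem tint_simps \<tau>_def \<tau>e_def)
    moreover have "(\<Prod>e\<in>E. cmod (csum \<alpha> I (\<lambda>_. F e))) = cmod \<tau> ^ (n - 1) * cmod (\<phi> r)"
    proof -
      have "(\<Prod>e'\<in>E - {e}. cmod (csum \<alpha> I (\<lambda>_. F e'))) = (\<Prod>e'\<in>E - {e}. cmod \<tau>)"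
        by (intro prod.cong) (auto simp: F_def \<tau>_def)
      then show ?thesis
        using e by (subst prod.remove[of _ e]) (simp_all add: F_def \<phi>_def)
    qed
    ultimately have "cmod (\<tau> + of_real r * \<tau>e) ^ n \<le> cmod \<tau> ^ (n - 1) * cmod (\<phi> r)"
      using hoelder[OF I, of F] by simp
    then have "(cmod (\<tau> + of_real r * \<tau>e) ^ n) ^ 2 \<le> (cmod \<tau> ^ (n - 1) * cmod (\<phi> r)) ^ 2"
      by (intro power_mono) auto
    then show ?thesis
      by (simp add: \<psi>_def power_mult_distrib power2_eq_square mult_ac)
  qed
  have "\<psi> 0 = 0"
    using power_minus_mult[OF n_pos, of "cmod \<tau> ^ 2"] by (simp add: \<psi>_def \<phi>0)
  then have "\<forall>y. \<bar>0 - y\<bar> < 1 \<longrightarrow> \<psi> 0 \<le> \<psi> y"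
    using \<psi>_nonneg by simp
  moreover have "(\<psi> has_real_derivative
      (cmod \<tau> ^ 2) ^ (n - 1) * (2 * Re (cnj \<tau> * D)) - n * (cmod \<tau> ^ 2) ^ (n - 1) * (2 * Re (cnj \<tau> * \<tau>e))) (at 0)"
  proof -
    have "((\<lambda>r. \<tau> + of_real r * \<tau>e) has_vector_derivative \<tau>e) (at 0)"
      by (rule derivative_eq_intros refl | simp)+
    from DERIV_power[OF has_real_derivative_cmod_squared[OF this], of n]
      DERIV_cmult[OF has_real_derivative_cmod_squared[OF \<phi>'], of "(cmod \<tau> ^ 2) ^ (n - 1)"]
    show ?thesis
      unfolding \<psi>_def by (auto dest: DERIV_diff simp: \<phi>0 mult_ac)
  qed
  ultimately have "(cmod \<tau> ^ 2) ^ (n - 1) * (2 * Re (cnj \<tau> * D))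
      - n * (cmod \<tau> ^ 2) ^ (n - 1) * (2 * Re (cnj \<tau> * \<tau>e)) = 0"
    using DERIV_local_min[OF _ zero_less_one] by blast
  then have "(cmod \<tau> ^ 2) ^ (n - 1) * (Re (cnj \<tau> * D) - n * Re (cnj \<tau> * \<tau>e)) = 0"
    by (simp add: algebra_simps)
  then show ?thesis
    using t by (simp add: \<tau>_def \<tau>e_def D_def)
qed

text \<open>
  If some vertex \<open>w\<close> of the first side had unequal numbers of edges of the two colours, then \<open>t\<close>
  would vanish at a nonzero matrix depending only on its first index.
\<close>

lemma balanced: "(\<Sum>e\<in>E. if \<alpha> e = 1 then 1 else - 1 :: real) = 0"
proof -
  define s where "s = (\<lambda>e. if \<alpha> e = 1 then 1 else - 1 :: real)"
  define d where "d = (\<lambda>w. \<Sum>e\<in>{e \<in> E. fst e = w}. s e)"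
  have "d w = 0" if w: "w \<in> V" for w
  proof (rule ccontr)
    assume dw: "d w \<noteq> 0"
    \<comment> \<open>The values are chosen so that the edges at \<open>w\<close> contribute 1 for
      one index and \<open>cis pi = - 1\<close> for the other, which cancel.\<close>
    define h where "h = (\<lambda>i::bool. if i then cis (pi / d w) else 1)"
    \<comment> \<open>A matrix depending only on its first index makes the sum over vertex maps
      factorise over vertices, with factors \<open>\<Sum>i\<in>UNIV. G w i\<close>.\<close>
    define G where "G = (\<lambda>w' i. \<Prod>e\<in>{e \<in> E. fst e = w'}. tint (\<alpha> e) (h i))"
    have "tint (\<alpha> e) (cis x) = cis (s e * x)" for e x
      by (simp add: tint_def s_def cis_cnj)
    then have "G w True = (\<Prod>e\<in>{e \<in> E. fst e = w}. cis (s e * (pi / d w)))"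
      by (simp add: G_def h_def)
    also have "\<dots> = cis (d w * (pi / d w))"
      unfolding d_def sum_distrib_right by (rule prod_cis)
    also have "\<dots> = - 1"
      using dw by simp
    finally have "(\<Sum>i\<in>UNIV. G w i) = 0"
      by (simp add: UNIV_bool G_def h_def tint_simps)
    then have "(\<Prod>w\<in>V. \<Sum>i\<in>UNIV. G w i) = 0"
      using w by (intro prod_zero) auto
    also have "(\<Prod>w\<in>V. \<Sum>i\<in>UNIV. G w i) = (\<Sum>z \<in> V \<rightarrow>\<^sub>E UNIV. \<Prod>w\<in>V. G w (z w))"
      by (intro prod_sum_PiE) auto
    also have "\<dots> = csum \<alpha> UNIV (\<lambda>_ i j. h i)"
    proof -
      have "(\<Prod>w\<in>V. G w (z w)) = (\<Prod>e\<in>E. tint (\<alpha> e) (h (z (fst e))))" for z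
      proof -
        have "(\<Prod>w\<in>V. G w (z w)) = (\<Prod>w\<in>V. \<Prod>e\<in>{e \<in> E. fst e = w}. tint (\<alpha> e) (h (z (fst e))))"
          unfolding G_def by (intro prod.cong) auto
        also have "\<dots> = (\<Prod>e\<in>E. tint (\<alpha> e) (h (z (fst e))))"
          by (intro prod.group) (auto dest: edge_ends)
        finally show ?thesis .
      qed
      then show ?thesis
        by (simp add: csum_def hsum_def)
    qed
    finally show False
      using csum_nonzero[of UNIV False False "\<lambda>i j. h i"] by (simp add: h_def)
  qed
  then have "(\<Sum>w\<in>V. d w) = 0"
    by simp
  also have "(\<Sum>w\<in>V. d w) = (\<Sum>e\<in>E. s e)"
    unfolding d_def by (intro sum.group) (auto dest: edge_ends)
  finally show ?thesis
    by (simp add: s_def)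
qed

text \<open>
  Applied to the direction \<open>\<i> g\<close>, \<open>directional_derivative_edge\<close> shows that the imaginary parts
  of the edge contributions agree up to the sign of the colour; they cancel since the colouring
  is balanced.
\<close>

lemma phase_derivative:
  assumes I: "finite I" "I \<noteq> {}" and t: "csum \<alpha> I (\<lambda>_. f) \<noteq> 0"
  shows "Im (cnj (csum \<alpha> I (\<lambda>_. f)) * (\<Sum>e\<in>E. csum \<alpha> I ((\<lambda>_. f)(e := g)))) = 0"
proof -
  define \<tau> where "\<tau> = csum \<alpha> I (\<lambda>_. f)"
  define s where "s = (\<lambda>e. if \<alpha> e = 1 then 1 else - 1 :: real)"
  define ig where "ig = (\<lambda>i j. \<i> * g i j)"
  define K where "K = Re (cnj \<tau> * (\<Sum>e\<in>E. csum \<alpha> I ((\<lambda>_. f)(e := ig))))"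
  have "Im (cnj \<tau> * csum \<alpha> I ((\<lambda>_. f)(e := g))) = s e * (- K / n)" if e: "e \<in> E" for e
  proof -
    \<comment> \<open>The scalar \<open>\<i>\<close> is conjugated on edges of colour other than 1,
      which produces the sign \<open>s e\<close>.\<close>
    have "csum \<alpha> I ((\<lambda>_. f)(e := ig)) = tint (\<alpha> e) \<i> * csum \<alpha> I ((\<lambda>_. f)(e := g))"
      using csum_upd_add[OF e, of \<alpha> I "\<lambda>_. f" "\<lambda>_ _. 0" \<i> g] csum_eq_0[OF e, of I "(\<lambda>_. f)(e := \<lambda>_ _. 0)" \<alpha>]
      by (simp add: ig_def)
    also have "\<dots> = \<i> * of_real (s e) * csum \<alpha> I ((\<lambda>_. f)(e := g))"
      by (simp add: tint_def s_def)
    finally have "K = n * Re (cnj \<tau> * (\<i> * of_real (s e) * csum \<alpha> I ((\<lambda>_. f)(e := g))))"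
      using directional_derivative_edge[OF I t e, of ig] by (simp add: K_def \<tau>_def)
    also have "cnj \<tau> * (\<i> * of_real (s e) * csum \<alpha> I ((\<lambda>_. f)(e := g)))
      = \<i> * (of_real (s e) * (cnj \<tau> * csum \<alpha> I ((\<lambda>_. f)(e := g))))"
      by simp
    also have "Re \<dots> = - (s e * Im (cnj \<tau> * csum \<alpha> I ((\<lambda>_. f)(e := g))))"
      by (simp add: algebra_simps)
    finally have "K = - (n * (s e * Im (cnj \<tau> * csum \<alpha> I ((\<lambda>_. f)(e := g)))))"
      by simp
    then have "s e * K = - (n * (s e * s e) * Im (cnj \<tau> * csum \<alpha> I ((\<lambda>_. f)(e := g))))"
      by simp
    moreover have "s e * s e = 1"
      by (simp add: s_def)
    ultimately have "s e * K = - (n * Im (cnj \<tau> * csum \<alpha> I ((\<lambda>_. f)(e := g))))"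
      by simp
    then have "Im (cnj \<tau> * csum \<alpha> I ((\<lambda>_. f)(e := g))) = - (s e * K) / n"
      using n_pos by (simp only: nonzero_eq_divide_eq) simp
    then show ?thesis
      by simp
  qed
  then have "(\<Sum>e\<in>E. Im (cnj \<tau> * csum \<alpha> I ((\<lambda>_. f)(e := g)))) = (\<Sum>e\<in>E. s e) * (- K / n)"
    unfolding sum_distrib_right by (intro sum.cong) auto
  also have "(\<Sum>e\<in>E. s e) = 0"
    using balanced by (simp add: s_def)
  finally show ?thesis
    by (simp only: \<tau>_def sum_distrib_left Im_sum mult_zero_left)
qed

text \<open>On the line through the all-ones matrix and \<open>f\<close> the coloured sum never
  vanishes: the zero entry of \<open>f\<close> becomes \<open>1 - s\<close>, and at
  \<open>s = 1\<close> the nonzero entry serves. The phase is therefore constant along the line, and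
  at \<open>s = 0\<close> the value is positive.\<close>

lemma csum_positive:
  assumes I: "finite I" and ij: "i \<in> I" "j \<in> I" "f i j = 0" and kl: "k \<in> I" "l \<in> I" "f k l \<noteq> 0"
  shows "csum \<alpha> I (\<lambda>_. f) = of_real (cmod (csum \<alpha> I (\<lambda>_. f)))"
proof -
  have I': "I \<noteq> {}"
    using ij by auto
  define g where "g = (\<lambda>i j. f i j - 1)"
  define \<phi> where "\<phi> = (\<lambda>s::real. csum \<alpha> I (\<lambda>_ i j. 1 + of_real s * g i j))"
  define \<phi>' where "\<phi>' = (\<lambda>s::real. \<Sum>e\<in>E. csum \<alpha> I ((\<lambda>_ i j. 1 + of_real s * g i j)(e := g)))"
  have \<phi>': "(\<phi> has_vector_derivative \<phi>' s) (at s)" for s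
    unfolding \<phi>_def \<phi>'_def by (rule csum_deriv)
  have nz: "\<phi> s \<noteq> 0" for s
  proof (cases "s = 1")
    case True
    then show ?thesis
      unfolding \<phi>_def using csum_nonzero[OF I kl(1,2), of f] kl(3) True by (simp add: g_def)
  next
    case False
    then have "1 + of_real s * g i j \<noteq> 0"
      using ij(3) by (simp add: g_def complex_eq_iff)
    then show ?thesis
      unfolding \<phi>_def by (intro csum_nonzero[OF I ij(1,2)])
  qed
  have Im0: "Im (cnj (\<phi> s) * \<phi>' s) = 0" for s
    using phase_derivative[OF I I' nz[unfolded \<phi>_def]] by (simp add: \<phi>_def \<phi>'_def)
  \<comment> \<open>The cosine of the phase; the value 1 forces \<open>\<phi> s\<close> to be a
    positive real number.\<close>
  define U where "U = (\<lambda>s. Re (\<phi> s) / cmod (\<phi> s))"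
  have "(U has_real_derivative 0) (at s)" for s
  proof -
    define u v u' v' m where "u = Re (\<phi> s)" and "v = Im (\<phi> s)" and "u' = Re (\<phi>' s)"
      and "v' = Im (\<phi>' s)" and "m = cmod (\<phi> s)"
    have m: "m > 0" "m ^ 2 = u ^ 2 + v ^ 2"
      using nz[of s] by (auto simp: m_def u_def v_def cmod_power2)
    have uv: "v' * u = u' * v"
      using Im0[of s] by (simp add: u_def v_def u'_def v'_def algebra_simps)
    have Re': "((\<lambda>r. Re (\<phi> r)) has_real_derivative u') (at s)"
      using \<phi>'[of s] by (simp add: has_vector_derivative_complex_iff u'_def)
    have "((\<lambda>r. sqrt (cmod (\<phi> r) ^ 2)) has_real_derivative
        inverse m / 2 * (2 * (u * u' + v * v'))) (at s)"
      using DERIV_chain2[OF DERIV_real_sqrt has_real_derivative_cmod_squared[OF \<phi>'], of s] m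
      by (simp add: u_def v_def u'_def v'_def m_def)
    moreover have "inverse m / 2 * (2 * (u * u' + v * v')) = (u * u' + v * v') / m"
      by (simp only: divide_inverse) simp
    ultimately have "((\<lambda>r. sqrt (cmod (\<phi> r) ^ 2)) has_real_derivative (u * u' + v * v') / m) (at s)"
      by (simp only:)
    then have cmod': "((\<lambda>r. cmod (\<phi> r)) has_real_derivative (u * u' + v * v') / m) (at s)"
      by (simp only: real_sqrt_abs abs_norm_cancel)
    have "(U has_real_derivative (u' * m - u * ((u * u' + v * v') / m)) / (m * m)) (at s)"
      using DERIV_divide[OF Re' cmod'] nz[of s] unfolding U_def by (simp add: u_def m_def)
    moreover have "u' * m - u * ((u * u' + v * v') / m) = (u' * m ^ 2 - u * (u * u' + v * v')) / m"
      using m(1) by (simp add: field_simps power2_eq_square)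
    \<comment> \<open>The last factor vanishes by \<open>uv\<close>, which is the statement
      \<open>Im0\<close> in coordinates.\<close>
    moreover have "u' * m ^ 2 - u * (u * u' + v * v') = v * (u' * v - v' * u)"
      unfolding m(2) by (simp add: algebra_simps power2_eq_square)
    ultimately show ?thesis
      using uv by simp
  qed
  then have "U 1 = U 0"
    using DERIV_isconst_all by blast
  also have "U 0 = 1"
    using nz[of 0] by (simp add: U_def \<phi>_def csum_one flip: of_nat_power)
  finally have "Re (\<phi> 1) = cmod (\<phi> 1)"
    using nz[of 1] by (simp add: U_def)
  moreover from this have "Im (\<phi> 1) = 0"
    using cmod_power2[of "\<phi> 1"] by simp
  ultimately have "\<phi> 1 = of_real (cmod (\<phi> 1))"
    by (simp add: complex_eq_iff)
  then show ?thesis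
    by (simp add: \<phi>_def g_def)
qed

end

section \<open>Comparison of the two colourings by a Fourier coefficient\<close>

theorem theorem1p2:
  fixes H :: "'v bigraph" and \<alpha> \<beta> :: "'v \<times> 'v \<Rightarrow> nat"
  assumes "bipartite_graph H"
    and "complex_norming H"
    and "edge_colouring H \<alpha>"
    and "edge_colouring H \<beta>"
    and "complex_norming_pair H \<alpha>"
    and "complex_norming_pair H \<beta>"
  shows "\<exists>\<phi>. bigraph_automorphism H \<phi> \<and>
             (\<forall>e \<in> bedges H. \<alpha> e = \<beta> (map_prod \<phi> \<phi> e))"
proof -
  interpret \<alpha>: norming_colouring H \<alpha>
    using assms by unfold_locales
  interpret \<beta>: norming_colouring H \<beta>
    using assms by unfold_locales
  let ?E = "bedges H" and ?V = "sideA H \<union> sideB H"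
  obtain e where e: "e \<in> ?E"
    using \<alpha>.E_nonempty by blast
  note ends = \<alpha>.edge_ends[OF e]
  have V: "finite ?V" "?V \<noteq> {}"
    using ends by auto
  obtain W :: "complex set" where W: "finite W" "card W > 0" "\<And>w. w \<in> W \<Longrightarrow> w \<noteq> 0"
    "\<And>p q. p < card ?E + 2 \<Longrightarrow> q < card ?E + 2 \<Longrightarrow>
      (\<Sum>w\<in>W. w ^ p * cnj w ^ q) = (if p = q then of_nat (card W) else 0)"
    by (rule ex_orthogonal_roots_of_unity[of "card ?E + 2"]) (rule that)
  have "\<alpha>.csum \<alpha> ?V (\<lambda>_. \<alpha>.edge_matrix x) = \<alpha>.csum \<beta> ?V (\<lambda>_. \<alpha>.edge_matrix x)"
    if x: "x \<in> ?E \<rightarrow>\<^sub>E W" for x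
  proof -
    \<comment> \<open>The diagonal entry at \<open>fst e\<close> is 0 and the entry at
      \<open>e\<close> is a nonzero weight; these are the two entries that
      \<open>csum_positive\<close> asks for.\<close>
    have "(fst e, fst e) \<notin> ?E"
      using \<alpha>.edge_ends(2)[of "(fst e, fst e)"] ends(1) \<alpha>.sides_disjoint by auto
    then have zero: "\<alpha>.edge_matrix x (fst e) (fst e) = 0"
      by simp
    have "x e \<noteq> 0"
      using x e W(3) by (auto simp: PiE_iff)
    then have nonzero: "\<alpha>.edge_matrix x (fst e) (snd e) \<noteq> 0"
      using e by simp
    have "cmod (\<alpha>.csum \<alpha> ?V (\<lambda>_. \<alpha>.edge_matrix x)) = cmod (\<alpha>.csum \<beta> ?V (\<lambda>_. \<alpha>.edge_matrix x))"
      using \<alpha>.csum_recolour_le[OF V] \<beta>.csum_recolour_le[OF V] by (rule antisym[rotated])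
    then show ?thesis
      using \<alpha>.csum_positive[where f = "\<alpha>.edge_matrix x", OF V(1) ends(3,3) zero ends(3,4) nonzero]
        \<beta>.csum_positive[where f = "\<alpha>.edge_matrix x", OF V(1) ends(3,3) zero ends(3,4) nonzero]
      by simp
  qed
  \<comment> \<open>The same coefficient, taken against the reference monomial of
    \<open>\<alpha>\<close>, is extracted from both sums.\<close>
  then have "(\<Sum>x \<in> ?E \<rightarrow>\<^sub>E W. \<alpha>.csum \<alpha> ?V (\<lambda>_. \<alpha>.edge_matrix x) * (\<Prod>e\<in>?E. cnj (tint (\<alpha> e) (x e)))) =
      (\<Sum>x \<in> ?E \<rightarrow>\<^sub>E W. \<alpha>.csum \<beta> ?V (\<lambda>_. \<alpha>.edge_matrix x) * (\<Prod>e\<in>?E. cnj (tint (\<alpha> e) (x e))))"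
    by (intro sum.cong refl arg_cong2[where f = times])
  then have "(of_nat (card W ^ card ?E * card {z \<in> ?V \<rightarrow>\<^sub>E ?V. \<alpha>.colour_hom \<alpha> \<alpha> z}) :: complex) =
      of_nat (card W ^ card ?E * card {z \<in> ?V \<rightarrow>\<^sub>E ?V. \<alpha>.colour_hom \<beta> \<alpha> z})"
    using \<alpha>.fourier_coefficient[OF W(1) W(4), of \<alpha> \<alpha>] \<alpha>.fourier_coefficient[OF W(1) W(4), of \<beta> \<alpha>]
    by (simp only:)
  then have "card W ^ card ?E * card {z \<in> ?V \<rightarrow>\<^sub>E ?V. \<alpha>.colour_hom \<alpha> \<alpha> z} =
      card W ^ card ?E * card {z \<in> ?V \<rightarrow>\<^sub>E ?V. \<alpha>.colour_hom \<beta> \<alpha> z}"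
    by (simp only: of_nat_eq_iff)
  \<comment> \<open>The identity is counted on the left, so some \<open>z\<close> must be counted on
    the right.\<close>
  moreover have "card {z \<in> ?V \<rightarrow>\<^sub>E ?V. \<alpha>.colour_hom \<alpha> \<alpha> z} > 0"
  proof -
    have "restrict id ?V \<in> {z \<in> ?V \<rightarrow>\<^sub>E ?V. \<alpha>.colour_hom \<alpha> \<alpha> z}"
      using \<alpha>.colour_hom_id by auto
    moreover have "finite {z \<in> ?V \<rightarrow>\<^sub>E ?V. \<alpha>.colour_hom \<alpha> \<alpha> z}"
      by (rule finite_subset[OF _ \<alpha>.finite_maps[OF V(1)]]) auto
    ultimately show ?thesis
      unfolding card_gt_0_iff by blast
  qed
  ultimately have "card {z \<in> ?V \<rightarrow>\<^sub>E ?V. \<alpha>.colour_hom \<beta> \<alpha> z} > 0"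
    using W(2) by simp
  then obtain z where "z \<in> ?V \<rightarrow>\<^sub>E ?V" "\<alpha>.colour_hom \<beta> \<alpha> z"
    by (auto simp: card_gt_0_iff)
  then show ?thesis
    using \<alpha>.colour_hom_automorphism[OF _ _ assms(3,4)] by metis
qed

end
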